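(* One-dimensional Euclidean preference profiles cannot be characterized in terms of finitely many obstructions. That is, there is no finite set $\mathcal{O}$ of obstructions such that for every preference profile $\mathcal{P}$: $\mathcal{P}$ is one-dimensional Euclidean if and only if $\mathcal{P}$ contains no obstruction from $\mathcal{O}$.
   Context: A preference profile with $n$ voters $v_1,\dots,v_n$ and $m$ alternatives $1,\dots,m$ (with $n,m$ finite) assigns to each voter $v_i$ a strict linear order $\succ_i$ on the set of alternatives ($a\succ_i b$ means that $v_i$ strictly prefers $a$ to $b$). A preference profile is one-dimensional Euclidean if one can assign to every alternative $j$ a real number $E[j]$ and to every voter $v_i$ a real number $F[i]$ such that for every voter $v_i$ and every pair $a,b$ of alternatives, $a\succ_i b$ holds if and only if $|F[i]-E[a]|<|F[i]-E[b]|$. An obstruction (forbidden substructure) consists of a finite set $W$ of voters, a finite set $A$ of alternatives, and for each voter $w\in W$ a set $R_w\subseteq A\times A$ of required comparisons, where $(a,b)\in R_w$ means that $w$ must prefer $a$ to $b$ (so the orders of the voters in an obstruction may be specified only partially). A preference profile $\mathcal{P}$ contains the obstruction if there are an injective map $\phi$ from $W$ to the voters of $\mathcal{P}$ and an injective map $\psi$ from $A$ to the alternatives of $\mathcal{P}$ such that for every $w\in W$ and every $(a,b)\in R_w$, voter $\phi(w)$ prefers $\psi(a)$ to $\psi(b)$ in $\mathcal{P}$. *)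

theory Defs
  imports Complex_Main
begin

text \<open>
  The voters of a profile are the numbers \<open>1, \<dots>, n\<close> and its alternatives the numbers
  \<open>1, \<dots>, m\<close>. A pair \<open>(a, b) \<in> prefs P i\<close> means that voter \<open>i\<close> strictly prefers \<open>a\<close> to \<open>b\<close>.
\<close>

record profile =
  num_voters :: nat
  num_alts :: nat
  prefs :: "nat \<Rightarrow> nat rel"

definition voters :: "profile \<Rightarrow> nat set" where
  "voters P = {1..num_voters P}"

definition alts :: "profile \<Rightarrow> nat set" where
  "alts P = {1..num_alts P}"

text \<open>
  The inclusion is needed because \<^const>\<open>strict_linear_order_on\<close> does not confine the
  relation to its carrier.
\<close>

definition preference_profile :: "profile \<Rightarrow> bool" where
  "preference_profile P \<longleftrightarrow>
    (\<forall>i\<in>voters P. prefs P i \<subseteq> alts P \<times> alts P \<and> strict_linear_order_on (alts P) (prefs P i))"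

definition one_dim_euclidean :: "profile \<Rightarrow> bool" where
  "one_dim_euclidean P \<longleftrightarrow>
    (\<exists>(E :: nat \<Rightarrow> real) (F :: nat \<Rightarrow> real).
      \<forall>i\<in>voters P. \<forall>a\<in>alts P. \<forall>b\<in>alts P.
        (a, b) \<in> prefs P i \<longleftrightarrow> \<bar>F i - E a\<bar> < \<bar>F i - E b\<bar>)"

record ('w, 'a) obstruction =
  obs_voters :: "'w set"
  obs_alts :: "'a set"
  required :: "'w \<Rightarrow> 'a rel"

definition is_obstruction :: "('w, 'a) obstruction \<Rightarrow> bool" where
  "is_obstruction X \<longleftrightarrow>
    finite (obs_voters X) \<and> finite (obs_alts X) \<and>
    (\<forall>w\<in>obs_voters X. required X w \<subseteq> obs_alts X \<times> obs_alts X)"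

definition contains_obstruction :: "profile \<Rightarrow> ('w, 'a) obstruction \<Rightarrow> bool" where
  "contains_obstruction P X \<longleftrightarrow>
    (\<exists>\<phi> \<psi>. inj_on \<phi> (obs_voters X) \<and> \<phi> ` obs_voters X \<subseteq> voters P \<and>
           inj_on \<psi> (obs_alts X) \<and> \<psi> ` obs_alts X \<subseteq> alts P \<and>
           (\<forall>w\<in>obs_voters X. \<forall>(a, b)\<in>required X w. (\<psi> a, \<psi> b) \<in> prefs P (\<phi> w)))"

end

theory Submission
  imports Defs
begin

text \<open>
  Take \<open>N\<close> pairwise far apart intervals of the line, the \<open>j\<close>-th one having the alternatives
  \<open>2 j\<close> and \<open>2 j + 1\<close> as endpoints. A voter near the common centre of the intervals \<open>i\<close> and
  \<open>i + 1\<close> can express that interval \<open>i\<close> is the longer one. Letting voter \<open>i\<close> say so for every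
  \<open>i\<close> modulo \<open>N\<close> gives a cyclic, hence non-Euclidean profile; but if the opinion of a single
  voter \<open>s\<close> is ignored, lengths that decrease cyclically from \<open>s + 1\<close> to \<open>s\<close> realize all the others.
  So an obstruction with fewer than \<open>N\<close> voters that occurs in the cyclic profile also occurs in
  a Euclidean one.
\<close>

section \<open>Distances via midpoints, and sums of two powers of two\<close>

lemma closer_iff:
  fixes x y f :: real
  assumes "x < y"
  shows "\<bar>f - x\<bar> < \<bar>f - y\<bar> \<longleftrightarrow> 2 * f < x + y" and "\<bar>f - y\<bar> < \<bar>f - x\<bar> \<longleftrightarrow> x + y < 2 * f"
  using assms by (auto simp: abs_if)

text \<open>The sum lies strictly between \<open>2 ^ l\<close> and \<open>2 ^ (l + 1)\<close>, which
  fixes the larger exponent. The case \<open>j = k\<close> is allowed because two alternatives may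
  belong to the same interval.\<close>

lemma power2_sum_eq:
  fixes i j k l :: nat
  assumes "i < l" "j \<le> k" "(2::nat) ^ j + 2 ^ k = 2 ^ i + 2 ^ l"
  shows "j = i \<and> k = l"
proof -
  have il: "(2::nat) ^ i < 2 ^ l" using assms(1) by simp
  have jk: "(2::nat) ^ j \<le> 2 ^ k" using assms(2) by simp
  have pos: "(0::nat) < 2 ^ i" "(0::nat) < 2 ^ j" by simp_all
  have "(2::nat) ^ k < 2 ^ Suc l" using il assms(3) pos unfolding power_Suc by linarith
  hence "k \<le> l" using power_less_imp_less_exp[of "2::nat" k "Suc l"] by simp
  have "(2::nat) ^ l < 2 ^ Suc k" using jk assms(3) pos unfolding power_Suc by linarith
  hence "l \<le> k" using power_less_imp_less_exp[of "2::nat" l "Suc k"] by simp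
  with \<open>k \<le> l\<close> have "k = l" by simp
  thus ?thesis using assms(3) by simp
qed

section \<open>Intervals, voters and the resulting profiles\<close>

definition next_index :: "nat \<Rightarrow> nat \<Rightarrow> nat" where
  "next_index N i = (if i = N then 1 else i + 1)"

text \<open>The lengths decrease along the cyclic order \<open>s + 1, \<dots>, N, 1, \<dots>, s\<close>.\<close>

definition len :: "nat \<Rightarrow> nat \<Rightarrow> nat \<Rightarrow> real" where
  "len N s j = (if j \<le> s then real N else 2 * real N) + 1 - real j"

text \<open>
  A sum of two distinct powers of two determines its summands, so the only two pairs of alternatives
  whose centres are close to the voter \<open>i \<le> N\<close> come from the intervals \<open>i\<close> and \<open>i + 1\<close>.
\<close>

definition pos :: "nat \<Rightarrow> nat \<Rightarrow> nat \<Rightarrow> real" where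
  "pos N s a = 8 * real N * 2 ^ (a div 2) + (if odd a then len N s (a div 2) else 0)"

text \<open>Voters \<open>1, ..., N\<close> stand at the mean of the ends of two cyclically adjacent
  intervals, voters \<open>N + 1\<close> and \<open>N + 2\<close> to the left and to the right of
  all alternatives.\<close>

definition loc :: "nat \<Rightarrow> nat \<Rightarrow> nat \<Rightarrow> real" where
  "loc N s i =
    (if i \<le> N then (\<Sum>j\<in>{i, next_index N i}. pos N s (2 * j) + pos N s (2 * j + 1)) / 4
     else if i = N + 1 then 0 else 8 * real N * 2 ^ (N + 2))"

text \<open>
  Voter \<open>i\<close> behaves as in the embedding with parameter \<open>\<sigma> i\<close>: a constant \<open>\<sigma>\<close> gives a
  Euclidean profile, and \<open>\<sigma> i \<noteq> i\<close> for all \<open>i \<le> N\<close> gives the cyclic one.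
\<close>

definition interval_profile :: "nat \<Rightarrow> (nat \<Rightarrow> nat) \<Rightarrow> profile" where
  "interval_profile N \<sigma> =
    \<lparr>num_voters = N + 2, num_alts = 2 * N + 1,
     prefs = \<lambda>i. {(a, b). a \<in> {1..2 * N + 1} \<and> b \<in> {1..2 * N + 1} \<and>
       \<bar>loc N (\<sigma> i) i - pos N (\<sigma> i) a\<bar> < \<bar>loc N (\<sigma> i) i - pos N (\<sigma> i) b\<bar>}\<rparr>"

lemma interval_profile_sel [simp]:
  "voters (interval_profile N \<sigma>) = {1..N + 2}"
  "alts (interval_profile N \<sigma>) = {1..2 * N + 1}"
  "(a, b) \<in> prefs (interval_profile N \<sigma>) i \<longleftrightarrow> a \<in> {1..2 * N + 1} \<and> b \<in> {1..2 * N + 1} \<and>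
     \<bar>loc N (\<sigma> i) i - pos N (\<sigma> i) a\<bar> < \<bar>loc N (\<sigma> i) i - pos N (\<sigma> i) b\<bar>"
  by (simp_all add: interval_profile_def voters_def alts_def)

section \<open>Lengths and positions\<close>

lemma next_index_mem: "i \<in> {1..N} \<Longrightarrow> next_index N i \<in> {1..N}"
  by (auto simp: next_index_def)

lemma next_index_neq: "2 \<le> N \<Longrightarrow> next_index N i \<noteq> i"
  by (auto simp: next_index_def)

lemma len_bounds:
  assumes "j \<le> N"
  shows "1 \<le> len N s j" "len N s j \<le> 2 * real N + 1"
  using assms by (auto simp: len_def)

lemma len_next_less:
  assumes "i \<in> {1..N}" "s \<in> {1..N}" "s \<noteq> i"
  shows "len N s (next_index N i) < len N s i"
  using assms by (auto simp: len_def next_index_def)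

text \<open>Includes \<open>i = s\<close>, where the length jumps up; this keeps voter
  \<open>s\<close> free of ties.\<close>

lemma len_next_neq:
  assumes "2 \<le> N" "i \<in> {1..N}" "s \<in> {1..N}"
  shows "len N s (next_index N i) \<noteq> len N s i"
  using assms by (auto simp: len_def next_index_def)

text \<open>Left ends of different intervals are at least \<open>8 * real N\<close> apart, more than
  the maximal length \<open>2 * real N + 1\<close>.\<close>

lemma pos_less:
  assumes "1 \<le> N" "a < b" "b \<le> 2 * N + 1"
  shows "pos N s a < pos N s b"
proof (cases "a div 2 = b div 2")
  case True
  have "even a" "odd b" using True \<open>a < b\<close> by presburger+
  moreover have "1 \<le> len N s (b div 2)" by (rule len_bounds) (use assms in linarith)
  ultimately show ?thesis using True by (simp add: pos_def)
next
  case False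
  have lt: "a div 2 < b div 2" using False \<open>a < b\<close> by linarith
  have "(2::real) ^ Suc (a div 2) \<le> 2 ^ (b div 2)" using lt by (intro power_increasing) auto
  moreover have "(1::real) \<le> 2 ^ (a div 2)" by simp
  ultimately have "(2::real) ^ (a div 2) + 1 \<le> 2 ^ (b div 2)" by (simp only: power_Suc)
  hence "8 * real N * (2 ^ (a div 2) + 1) \<le> 8 * real N * 2 ^ (b div 2)"
    by (intro mult_left_mono) auto
  hence "8 * real N * 2 ^ (a div 2) + 8 * real N \<le> 8 * real N * 2 ^ (b div 2)"
    by (simp add: algebra_simps)
  moreover have "len N s (a div 2) \<le> 2 * real N + 1" "0 \<le> len N s (b div 2)"
    using len_bounds[of "a div 2" N s] len_bounds[of "b div 2" N s] assms by linarith+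
  moreover have "1 \<le> real N" using assms by simp
  ultimately show ?thesis using lt by (simp add: pos_def)
qed

section \<open>Midpoints of alternatives compared with voters\<close>

lemma loc_interval:
  assumes "2 \<le> N" "i \<in> {1..N}"
  shows "2 * loc N s i = 8 * real N * (2 ^ i + 2 ^ next_index N i)
           + (len N s i + len N s (next_index N i)) / 2"
  using assms next_index_neq[of N i]
  by (simp add: loc_def pos_def eq_commute[of i] algebra_simps add_divide_distrib)

text \<open>
  The combinatorial content of \<open>2 * loc N s i < pos N s a + pos N s b\<close>, for \<open>a < b\<close> and \<open>s \<noteq> i\<close>.
\<close>

definition right_of :: "nat \<Rightarrow> nat \<Rightarrow> nat \<Rightarrow> nat \<Rightarrow> bool" where
  "right_of N i a b \<longleftrightarrow>
    (if i \<le> N then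
       (2::nat) ^ i + 2 ^ next_index N i < 2 ^ (a div 2) + 2 ^ (b div 2) \<or>
       (2::nat) ^ i + 2 ^ next_index N i = 2 ^ (a div 2) + 2 ^ (b div 2) \<and> 2 * i + 1 \<in> {a, b}
     else i = N + 1)"

text \<open>The powers of two decide, unless one alternative belongs to interval \<open>i\<close>
  and the other to \<open>next_index N i\<close>; then the lengths decide.\<close>

lemma centre_interval:
  assumes "2 \<le> N" "i \<in> {1..N}" "s \<in> {1..N}" "a < b" "b \<le> 2 * N + 1"
  shows "pos N s a + pos N s b \<noteq> 2 * loc N s i"
    and "s \<noteq> i \<Longrightarrow> 2 * loc N s i < pos N s a + pos N s b \<longleftrightarrow> right_of N i a b"
proof -
  define j k i' where "j = a div 2" and "k = b div 2" and "i' = next_index N i"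
  define d where "d n t = (if odd t then len N s n else 0)" for n t :: nat
  have ab: "pos N s a + pos N s b = 8 * real N * (2 ^ j + 2 ^ k) + d j a + d k b"
    by (simp add: pos_def j_def k_def d_def algebra_simps)
  have loc: "2 * loc N s i = 8 * real N * (2 ^ i + 2 ^ i') + (len N s i + len N s i') / 2"
    using loc_interval[OF assms(1,2)] by (simp add: i'_def)
  have jk: "j \<le> k" "k \<le> N" "i' \<in> {1..N}" "i' \<noteq> i"
    using assms next_index_mem[of i N] next_index_neq[of N i]
    by (auto simp: j_def k_def i'_def)
  have d: "0 \<le> d j a" "d j a \<le> 2 * real N + 1" "0 \<le> d k b" "d k b \<le> 2 * real N + 1"
    using len_bounds[of j N s] len_bounds[of k N s] jk by (auto simp: d_def)
  have l: "1 \<le> len N s i" "len N s i \<le> 2 * real N + 1"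
      "1 \<le> len N s i'" "len N s i' \<le> 2 * real N + 1"
    using len_bounds[of i N s] len_bounds[of i' N s] jk assms by auto
  have N: "2 \<le> real N" using assms by simp
  \<comment> \<open>A gap of one between the integer sums becomes \<open>8 * real N\<close>, which
    outweighs all length terms.\<close>
  have scaled: "8 * real N * (2 ^ u + 2 ^ v) + 8 * real N \<le> 8 * real N * (2 ^ p + 2 ^ q)"
    if "(2::nat) ^ u + 2 ^ v < 2 ^ p + 2 ^ q" for u v p q :: nat
  proof -
    have "real (2 ^ u + 2 ^ v + 1) \<le> real (2 ^ p + 2 ^ q)"
      using that by (intro of_nat_mono) linarith
    hence "8 * real N * (2 ^ u + 2 ^ v + 1) \<le> 8 * real N * (2 ^ p + 2 ^ q)"
      by (intro mult_left_mono) auto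
    thus ?thesis by (simp add: algebra_simps)
  qed
  have right: "right_of N i a b \<longleftrightarrow> (2::nat) ^ i + 2 ^ i' < 2 ^ j + 2 ^ k \<or>
     (2::nat) ^ i + 2 ^ i' = 2 ^ j + 2 ^ k \<and> 2 * i + 1 \<in> {a, b}"
    using assms by (simp add: right_of_def j_def k_def i'_def)
  consider "(2::nat) ^ i + 2 ^ i' < 2 ^ j + 2 ^ k" | "(2::nat) ^ j + 2 ^ k < 2 ^ i + 2 ^ i'"
    | "(2::nat) ^ j + 2 ^ k = 2 ^ i + 2 ^ i'" by linarith
  hence "pos N s a + pos N s b \<noteq> 2 * loc N s i \<and>
    (s \<noteq> i \<longrightarrow> (2 * loc N s i < pos N s a + pos N s b \<longleftrightarrow> right_of N i a b))"
  proof cases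
    case 1
    have "2 * loc N s i < pos N s a + pos N s b"
      using scaled[OF 1] ab loc d l N by argo
    thus ?thesis using 1 right by simp
  next
    case 2
    have "pos N s a + pos N s b < 2 * loc N s i"
      using scaled[OF 2] ab loc d l N by argo
    thus ?thesis using 2 right by simp
  next
    case 3
    hence ids: "j = i \<and> k = i' \<or> j = i' \<and> k = i"
      using power2_sum_eq[of i i' j k] power2_sum_eq[of i' i j k] jk by force
    have "(2::real) ^ j + 2 ^ k = 2 ^ i + 2 ^ i'" using ids by auto
    hence diff: "pos N s a + pos N s b - 2 * loc N s i = d j a + d k b - (len N s i + len N s i') / 2"
      using ab loc by simp
    have neq: "len N s i' \<noteq> len N s i" using len_next_neq assms by (simp add: i'_def)
    have less: "len N s i' < len N s i" if "s \<noteq> i"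
      using len_next_less assms that by (simp add: i'_def)
    have odd_a: "2 * i + 1 = a \<longleftrightarrow> odd a \<and> j = i" and odd_b: "2 * i + 1 = b \<longleftrightarrow> odd b \<and> k = i"
      unfolding j_def k_def by presburger+
    \<comment> \<open>The offsets add up to zero, one length or both. They exceed the mean length
      exactly when the longer length is included; for \<open>s \<noteq> i\<close> that is the one of
      interval \<open>i\<close>.\<close>
    show ?thesis
      using ids diff neq less l 3 odd_a odd_b jk(4) unfolding right d_def
      by (cases "odd a"; cases "odd b") (auto simp: field_simps)
  qed
  thus "pos N s a + pos N s b \<noteq> 2 * loc N s i"
    and "s \<noteq> i \<Longrightarrow> 2 * loc N s i < pos N s a + pos N s b \<longleftrightarrow> right_of N i a b" by auto
qed

lemma pos_bounds:
  assumes "1 \<le> N" "a \<le> 2 * N + 1"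
  shows "0 < pos N s a" "pos N s a < 8 * real N * 2 ^ (N + 1)"
proof -
  have "0 < pos N s 0" using assms by (simp add: pos_def)
  thus "0 < pos N s a" using pos_less[of N 0 a s] assms by (cases "a = 0") auto
  have "pos N s a \<le> pos N s (2 * N + 1)"
    using pos_less[of N a "2 * N + 1" s] assms by (cases "a = 2 * N + 1") auto
  also have "\<dots> = 8 * real N * 2 ^ N + len N s N" by (simp add: pos_def)
  also have "\<dots> < 8 * real N * 2 ^ N + 8 * real N * 1"
    using len_bounds[of N N s] assms by simp
  also have "\<dots> \<le> 8 * real N * 2 ^ N + 8 * real N * 2 ^ N"
    by (intro add_left_mono mult_left_mono) auto
  finally show "pos N s a < 8 * real N * 2 ^ (N + 1)" by simp
qed

lemma centre:
  assumes "2 \<le> N" "i \<in> {1..N + 2}" "s \<in> {1..N}" "a < b" "b \<le> 2 * N + 1"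
  shows "pos N s a + pos N s b \<noteq> 2 * loc N s i"
    and "s \<noteq> i \<Longrightarrow> 2 * loc N s i < pos N s a + pos N s b \<longleftrightarrow> right_of N i a b"
proof -
  have b: "0 < pos N s a" "0 < pos N s b"
      "pos N s a < 8 * real N * 2 ^ (N + 1)" "pos N s b < 8 * real N * 2 ^ (N + 1)"
    using pos_bounds[of N a s] pos_bounds[of N b s] assms by auto
  consider "i \<in> {1..N}" | "i = N + 1" | "i = N + 2" using assms(2) by force
  hence "pos N s a + pos N s b \<noteq> 2 * loc N s i \<and>
    (s \<noteq> i \<longrightarrow> (2 * loc N s i < pos N s a + pos N s b \<longleftrightarrow> right_of N i a b))"
  proof cases
    case 1
    thus ?thesis using centre_interval[of N i s a b] assms by blast
  next
    case 2
    thus ?thesis using b by (simp add: loc_def right_of_def)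
  next
    case 3
    thus ?thesis using b by (simp add: loc_def right_of_def)
  qed
  thus "pos N s a + pos N s b \<noteq> 2 * loc N s i"
    and "s \<noteq> i \<Longrightarrow> 2 * loc N s i < pos N s a + pos N s b \<longleftrightarrow> right_of N i a b" by auto
qed

section \<open>Rankings of the voters\<close>

lemma no_ties:
  assumes "2 \<le> N" "i \<in> {1..N + 2}" "s \<in> {1..N}"
    "a \<in> {1..2 * N + 1}" "b \<in> {1..2 * N + 1}" "a \<noteq> b"
  shows "\<bar>loc N s i - pos N s a\<bar> \<noteq> \<bar>loc N s i - pos N s b\<bar>"
  using assms
proof (induction a b rule: linorder_wlog)
  case (le a b)
  hence "pos N s a < pos N s b" using pos_less[of N a b s] by simp
  moreover have "pos N s a + pos N s b \<noteq> 2 * loc N s i"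
    using centre(1)[of N i s a b] le by simp
  ultimately show ?case by linarith
next
  case (sym a b)
  thus ?case by metis
qed

lemma preference_profile_interval_profile:
  assumes "2 \<le> N" "\<And>i. \<sigma> i \<in> {1..N}"
  shows "preference_profile (interval_profile N \<sigma>)"
  unfolding preference_profile_def strict_linear_order_on_def trans_def irrefl_def total_on_def
  using no_ties[OF assms(1) _ assms(2)] by (auto simp: linorder_neq_iff)

lemma one_dim_euclidean_interval_profile:
  "one_dim_euclidean (interval_profile N (\<lambda>_. s))"
  unfolding one_dim_euclidean_def
  by (intro exI[of _ "pos N s"] exI[of _ "loc N s"]) simp

lemma prefs_interval_profile:
  assumes "2 \<le> N" "i \<in> {1..N + 2}" "\<sigma> i \<in> {1..N}" "\<sigma> i \<noteq> i" "1 \<le> a" "a < b" "b \<le> 2 * N + 1"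
  shows "(a, b) \<in> prefs (interval_profile N \<sigma>) i \<longleftrightarrow> right_of N i a b"
    and "(b, a) \<in> prefs (interval_profile N \<sigma>) i \<longleftrightarrow> \<not> right_of N i a b"
proof -
  have "pos N (\<sigma> i) a < pos N (\<sigma> i) b" using pos_less assms by simp
  with centre[of N i "\<sigma> i" a b] assms
  show "(a, b) \<in> prefs (interval_profile N \<sigma>) i \<longleftrightarrow> right_of N i a b"
    and "(b, a) \<in> prefs (interval_profile N \<sigma>) i \<longleftrightarrow> \<not> right_of N i a b"
    by (auto simp: closer_iff)
qed

text \<open>Away from the parameter \<open>i\<close>, the ranking of voter \<open>i\<close> is given
  by \<open>right_of\<close>, which does not mention the parameter. Hence the cyclic profile agrees
  with a Euclidean one outside a single voter.\<close>

lemma prefs_interval_profile_cong: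
  assumes "2 \<le> N" "i \<in> {1..N + 2}" "\<sigma> i \<in> {1..N}" "\<sigma> i \<noteq> i" "\<tau> i \<in> {1..N}" "\<tau> i \<noteq> i"
  shows "prefs (interval_profile N \<sigma>) i = prefs (interval_profile N \<tau>) i"
proof -
  have "(a, b) \<in> prefs (interval_profile N \<sigma>) i \<longleftrightarrow> (a, b) \<in> prefs (interval_profile N \<tau>) i" for a b
  proof (cases "a \<in> {1..2 * N + 1} \<and> b \<in> {1..2 * N + 1}")
    case True
    consider "a < b" | "a = b" | "b < a" by linarith
    thus ?thesis
    proof cases
      case 1
      thus ?thesis using True assms prefs_interval_profile(1)[of N i _ a b]
        by (simp del: interval_profile_sel)
    next
      case 2
      thus ?thesis by simp
    next
      case 3
      thus ?thesis using True assms prefs_interval_profile(2)[of N i _ b a]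
        by (simp del: interval_profile_sel)
    qed
  qed auto
  thus ?thesis by (simp only: set_eq_iff split_paired_All simp_thms)
qed

section \<open>The cyclic profile is not Euclidean\<close>

text \<open>
  The voters \<open>N + 1\<close> and \<open>N + 2\<close> have opposite preferences, which forces the order of the
  alternatives up to reflection. An interval of minimal length then refutes its own voter.
\<close>

lemma cyclic_contradiction:
  fixes E F :: "nat \<Rightarrow> real"
  assumes N: "2 \<le> N"
    and up: "\<And>i a b. i \<in> {1..N + 2} \<Longrightarrow> 1 \<le> a \<Longrightarrow> a < b \<Longrightarrow> b \<le> 2 * N + 1 \<Longrightarrow>
      right_of N i a b \<Longrightarrow> \<bar>F i - E a\<bar> < \<bar>F i - E b\<bar>"
    and down: "\<And>i a b. i \<in> {1..N + 2} \<Longrightarrow> 1 \<le> a \<Longrightarrow> a < b \<Longrightarrow> b \<le> 2 * N + 1 \<Longrightarrow>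
      \<not> right_of N i a b \<Longrightarrow> \<bar>F i - E b\<bar> < \<bar>F i - E a\<bar>"
    and le: "F (N + 1) \<le> F (N + 2)"
  shows False
proof -
  have mono: "E a < E b" if "1 \<le> a" "a < b" "b \<le> 2 * N + 1" for a b
  proof -
    have "\<bar>F (N + 1) - E a\<bar> < \<bar>F (N + 1) - E b\<bar>"
      by (rule up) (use that in \<open>auto simp: right_of_def\<close>)
    moreover have "\<bar>F (N + 2) - E b\<bar> < \<bar>F (N + 2) - E a\<bar>"
      by (rule down) (use that in \<open>auto simp: right_of_def\<close>)
    ultimately show ?thesis using le by linarith
  qed
  have up': "2 * F i < E a + E b"
    if "i \<in> {1..N}" "1 \<le> a" "a < b" "b \<le> 2 * N + 1" "right_of N i a b" for i a b
    using up[of i a b] mono[of a b] that by (simp add: closer_iff)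
  have down': "E a + E b < 2 * F i"
    if "i \<in> {1..N}" "1 \<le> a" "a < b" "b \<le> 2 * N + 1" "\<not> right_of N i a b" for i a b
    using down[of i a b] mono[of a b] that by (simp add: closer_iff)
  have decrease: "E (2 * next_index N i + 1) - E (2 * next_index N i) < E (2 * i + 1) - E (2 * i)"
    if i: "i \<in> {1..N}" for i
  proof -
    define i' where "i' = next_index N i"
    have i': "i' \<in> {1..N}" "i' \<noteq> i"
      using next_index_mem[OF i] next_index_neq[OF N] by (auto simp: i'_def)
    have right: "right_of N i a b \<longleftrightarrow> 2 * i + 1 \<in> {a, b}"
      if "a div 2 = i \<and> b div 2 = i' \<or> a div 2 = i' \<and> b div 2 = i" for a b
      using i that by (auto simp: right_of_def i'_def)
    \<comment> \<open>The two mixed pairs have midpoints on opposite sides of voter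
      \<open>i\<close>. The case split on \<open>i < i'\<close> accounts for the wrap-around at
      \<open>i = N\<close>.\<close>
    have "E (2 * i) + E (2 * i' + 1) < 2 * F i"
      using down'[of i "2 * i" "2 * i' + 1"] down'[of i "2 * i' + 1" "2 * i"]
        right[of "2 * i" "2 * i' + 1"] right[of "2 * i' + 1" "2 * i"] i i'
      by (cases "i < i'") auto
    moreover have "2 * F i < E (2 * i + 1) + E (2 * i')"
      using up'[of i "2 * i + 1" "2 * i'"] up'[of i "2 * i'" "2 * i + 1"]
        right[of "2 * i + 1" "2 * i'"] right[of "2 * i'" "2 * i + 1"] i i'
      by (cases "i < i'") auto
    ultimately show ?thesis unfolding i'_def by linarith
  qed
  define g where "g i = E (2 * i + 1) - E (2 * i)" for i
  have "Min (g ` {1..N}) \<in> g ` {1..N}" using N by (intro Min_in) auto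
  then obtain i where i: "i \<in> {1..N}" "g i = Min (g ` {1..N})" by auto
  hence "g i \<le> g (next_index N i)" using next_index_mem[OF i(1)] by simp
  with decrease[OF i(1)] show False by (simp add: g_def)
qed

lemma not_one_dim_euclidean_interval_profile:
  assumes N: "2 \<le> N" and \<sigma>: "\<And>i. \<sigma> i \<in> {1..N}" "\<And>i. \<sigma> i \<noteq> i"
  shows "\<not> one_dim_euclidean (interval_profile N \<sigma>)"
proof
  assume "one_dim_euclidean (interval_profile N \<sigma>)"
  then obtain E F :: "nat \<Rightarrow> real" where EF: "\<And>i a b. i \<in> {1..N + 2} \<Longrightarrow> a \<in> {1..2 * N + 1} \<Longrightarrow>
      b \<in> {1..2 * N + 1} \<Longrightarrow>
      (a, b) \<in> prefs (interval_profile N \<sigma>) i \<longleftrightarrow> \<bar>F i - E a\<bar> < \<bar>F i - E b\<bar>"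
    unfolding one_dim_euclidean_def interval_profile_sel(1,2) by blast
  have up: "\<bar>F i - E a\<bar> < \<bar>F i - E b\<bar>"
    if "i \<in> {1..N + 2}" "1 \<le> a" "a < b" "b \<le> 2 * N + 1" "right_of N i a b" for i a b
    using EF[of i a b] prefs_interval_profile(1)[of N i \<sigma> a b] that N \<sigma>
    by (simp del: interval_profile_sel)
  have down: "\<bar>F i - E b\<bar> < \<bar>F i - E a\<bar>"
    if "i \<in> {1..N + 2}" "1 \<le> a" "a < b" "b \<le> 2 * N + 1" "\<not> right_of N i a b" for i a b
    using EF[of i b a] prefs_interval_profile(2)[of N i \<sigma> a b] that N \<sigma>
    by (simp del: interval_profile_sel)
  show False
  proof (cases "F (N + 1) \<le> F (N + 2)")
    case True
    show False by (rule cyclic_contradiction[OF N up down True])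
  next
    case False
    have reflect: "\<bar>- x - - y\<bar> = \<bar>x - y\<bar>" for x y :: real by simp
    show False
      \<comment> \<open>Reflecting the line keeps all distances and swaps the two outer
        voters.\<close>
      by (rule cyclic_contradiction[of N "\<lambda>i. - F i" "\<lambda>a. - E a"])
        (use N up down False in \<open>simp_all only: reflect, simp\<close>)
  qed
qed

section \<open>Finite sets of obstructions\<close>

theorem theorem3p2:
  shows "\<nexists>Obs :: ('w, 'a) obstruction set.
    finite Obs \<and> (\<forall>X\<in>Obs. is_obstruction X) \<and>
    (\<forall>P. preference_profile P \<longrightarrow>
      (one_dim_euclidean P \<longleftrightarrow> \<not> (\<exists>X\<in>Obs. contains_obstruction P X)))"
proof (rule notI, elim exE conjE)
  fix Obs :: "('w, 'a) obstruction set"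
  assume fin: "finite Obs" and obs: "\<forall>X\<in>Obs. is_obstruction X"
    and "\<forall>P. preference_profile P \<longrightarrow>
      (one_dim_euclidean P \<longleftrightarrow> \<not> (\<exists>X\<in>Obs. contains_obstruction P X))"
  hence char: "one_dim_euclidean P \<longleftrightarrow> \<not> (\<exists>X\<in>Obs. contains_obstruction P X)"
    if "preference_profile P" for P using that by blast
  \<comment> \<open>The sum bounds the number of voters of every obstruction in
    \<open>Obs\<close>.\<close>
  define N where "N = (\<Sum>X\<in>Obs. card (obs_voters X)) + 2"
  define \<sigma> :: "nat \<Rightarrow> nat" where "\<sigma> i = (if i = 1 then 2 else 1)" for i
  have N: "2 \<le> N" by (simp add: N_def)
  have \<sigma>: "\<sigma> i \<in> {1..N}" "\<sigma> i \<noteq> i" for i using N by (auto simp: \<sigma>_def)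
  obtain X where X: "X \<in> Obs" "contains_obstruction (interval_profile N \<sigma>) X"
    using char[OF preference_profile_interval_profile[of N \<sigma>, OF N \<sigma>(1)]]
      not_one_dim_euclidean_interval_profile[of N \<sigma>, OF N \<sigma>] by blast
  obtain \<phi> \<psi> where emb: "inj_on \<phi> (obs_voters X)" "\<phi> ` obs_voters X \<subseteq> {1..N + 2}"
      "inj_on \<psi> (obs_alts X)" "\<psi> ` obs_alts X \<subseteq> {1..2 * N + 1}"
      "\<forall>w\<in>obs_voters X. \<forall>(a, b)\<in>required X w. (\<psi> a, \<psi> b) \<in> prefs (interval_profile N \<sigma>) (\<phi> w)"
    using X(2) unfolding contains_obstruction_def interval_profile_sel(1,2)
    by (elim exE conjE) (rule that)
  have "card (obs_voters X) < N"
    using member_le_sum[OF X(1) _ fin, of "\<lambda>X. card (obs_voters X)"] by (simp add: N_def)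
  moreover have "finite (obs_voters X)" using obs X(1) by (simp add: is_obstruction_def)
  ultimately have "\<not> {1..N} \<subseteq> \<phi> ` obs_voters X"
    using card_mono[of "\<phi> ` obs_voters X" "{1..N}"] card_image_le[of "obs_voters X" \<phi>] by auto
  \<comment> \<open>Voter \<open>s\<close> is missed by the embedding, so the same maps embed
    \<open>X\<close> into the Euclidean profile with constant parameter \<open>s\<close>.\<close>
  then obtain s where s: "s \<in> {1..N}" "s \<notin> \<phi> ` obs_voters X" by blast
  have "prefs (interval_profile N \<sigma>) (\<phi> w) = prefs (interval_profile N (\<lambda>_. s)) (\<phi> w)"
    if "w \<in> obs_voters X" for w
    using that s emb(2) \<sigma> by (intro prefs_interval_profile_cong N) auto
  hence "contains_obstruction (interval_profile N (\<lambda>_. s)) X"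
    unfolding contains_obstruction_def interval_profile_sel(1,2)
    using emb by (intro exI[of _ \<phi>] exI[of _ \<psi>]) (simp del: interval_profile_sel)
  thus False
    using char[OF preference_profile_interval_profile[of N "\<lambda>_. s", OF N s(1)]] X(1)
      one_dim_euclidean_interval_profile[of N s] by blast
qed

end
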